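(* Let $Q$ be a quadrangulation and let $s$ be a bridge in $Q$. Let $Q_1$ (resp. $Q_2$) be the quadrangulation obtained from $Q$ by removing all squares from one side of $s$ (resp. from the other side), so that both $Q_1$ and $Q_2$ contain $s$. Then there is a bijection between serpent nests in $Q$ and pairs $(\sigma_1,\sigma_2)$ where $\sigma_1$ is a serpent nest in $Q_1$ and $\sigma_2$ is a serpent nest in $Q_2$.
   Context: Quadrangulations. A quadrangulation is a set of pairwise noncrossing diagonals (inner edges) of a convex polygon with $2n+2$ vertices ($n\ge1$), cutting it into quadrilaterals (there are $n$ of them, called squares, and $n-1$ inner edges). Two squares are neighbours (adjacent) if they share an inner edge; with this adjacency the squares form a tree. A square $s$ is a bridge if it has exactly two neighbour squares and these are attached to opposite edges of $s$. Serpents. A serpent in $Q$ is a set of two distinct squares $\{s',s''\}$ (its extremities) such that the unique path of squares from $s'$ to $s''$ makes a right-angle turn in each intermediate square, i.e. never enters and leaves a square through opposite sides. The serpent is also identified with this path, drawn from the centre of $s'$ to the centre of $s''$. Serpent nests. A serpent nest in $Q$ is an equivalence class of sets of serpents in $Q$ satisfying the condition: two serpent extremities may lie in the same square only if the corresponding serpents do not leave this square by the same side. Two such sets are equivalent if the pattern of paths inside every square is the same for both: for each square and each of its four sides, the number of path segments going from this side to the centre (and stopping there) is the same, and for each square and each of its four pairs of adjacent sides, the number of path segments entering by one and leaving by the other is the same. *)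

theory Defs
  imports Main
begin

text \<open>
  The vertices of a convex polygon are given by a finite subset of a linear order, read
  cyclically in increasing order (the successor of the largest element is the smallest one). Segments between
  vertices are two-element sets. Sub-polygons are then just subsets of the vertex set.
\<close>

record 'a dissection =
  vertices :: "'a set"
  inner_edges :: "'a set set"

definition sides :: "'a::linorder set \<Rightarrow> 'a set set" where
  "sides F = {{a, b} | a b. a \<in> F \<and> b \<in> F \<and> a < b \<and>
     ((\<forall>x\<in>F. \<not> (a < x \<and> x < b)) \<or> (\<forall>x\<in>F. a \<le> x \<and> x \<le> b))}"

definition diagonals :: "'a::linorder set \<Rightarrow> 'a set set" where
  "diagonals F = {e. e \<subseteq> F \<and> card e = 2} - sides F"

definition crossing :: "'a::linorder set \<Rightarrow> 'a set \<Rightarrow> bool" where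
  "crossing d e \<longleftrightarrow>
     (\<exists>a b x y. d = {a, b} \<and> e = {x, y} \<and> a < x \<and> x < b \<and> (y < a \<or> b < y))"

text \<open>
  The polygons into which the noncrossing inner edges cut the polygon, each one given by its vertex
  set: they are bounded by inner edges and sides of the polygon, and no inner edge cuts them.
\<close>

definition squares :: "'a::linorder dissection \<Rightarrow> 'a set set" where
  "squares Q = {F. F \<subseteq> vertices Q \<and> card F \<ge> 3 \<and>
     sides F \<subseteq> sides (vertices Q) \<union> inner_edges Q \<and> diagonals F \<inter> inner_edges Q = {}}"

definition quadrangulation :: "nat \<Rightarrow> 'a::linorder dissection \<Rightarrow> bool" where
  "quadrangulation n Q \<longleftrightarrow>
     n \<ge> 1 \<and> finite (vertices Q) \<and> card (vertices Q) = 2 * n + 2 \<and>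
     inner_edges Q \<subseteq> diagonals (vertices Q) \<and>
     (\<forall>d\<in>inner_edges Q. \<forall>e\<in>inner_edges Q. \<not> crossing d e) \<and>
     (\<forall>s\<in>squares Q. card s = 4)"

definition adjacent :: "'a::linorder dissection \<Rightarrow> 'a set \<Rightarrow> 'a set \<Rightarrow> bool" where
  "adjacent Q s t \<longleftrightarrow> s \<in> squares Q \<and> t \<in> squares Q \<and> s \<noteq> t \<and>
     (\<exists>e\<in>inner_edges Q. e \<in> sides s \<and> e \<in> sides t)"

definition neighbours :: "'a::linorder dissection \<Rightarrow> 'a set \<Rightarrow> 'a set set" where
  "neighbours Q s = {t. adjacent Q s t}"

text \<open>
  Two distinct squares have at most two common vertices, so the inner edge shared by two adjacent
  squares is their intersection.
\<close>

definition shared_edge :: "'a set \<Rightarrow> 'a set \<Rightarrow> 'a set" where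
  "shared_edge s t = s \<inter> t"

text \<open>Only meant for two sides of the same square.\<close>

definition opposite :: "'a set \<Rightarrow> 'a set \<Rightarrow> bool" where
  "opposite e f \<longleftrightarrow> e \<inter> f = {}"

definition bridge :: "'a::linorder dissection \<Rightarrow> 'a set \<Rightarrow> bool" where
  "bridge Q s \<longleftrightarrow> s \<in> squares Q \<and>
     (\<exists>t u. t \<noteq> u \<and> neighbours Q s = {t, u} \<and> opposite (shared_edge s t) (shared_edge s u))"

text \<open>
  The squares on the side of \<open>s\<close> where its neighbour \<open>t\<close> lies: those that can be reached
  from \<open>t\<close> without passing through \<open>s\<close>.
\<close>

definition branch :: "'a::linorder dissection \<Rightarrow> 'a set \<Rightarrow> 'a set \<Rightarrow> 'a set set" where
  "branch Q s t = {u. (t, u) \<in> {(v, w). adjacent Q v w \<and> v \<noteq> s \<and> w \<noteq> s}\<^sup>*}"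

definition remove_squares :: "'a::linorder dissection \<Rightarrow> 'a set set \<Rightarrow> 'a dissection" where
  "remove_squares Q R =
     \<lparr>vertices = \<Union>(squares Q - R),
      inner_edges = {e \<in> inner_edges Q.
        \<exists>s\<in>squares Q - R. \<exists>t\<in>squares Q - R. s \<noteq> t \<and> e \<in> sides s \<and> e \<in> sides t}\<rparr>"

definition square_path :: "'a::linorder dissection \<Rightarrow> 'a set list \<Rightarrow> bool" where
  "square_path Q p \<longleftrightarrow> distinct p \<and> (\<forall>i. Suc i < length p \<longrightarrow> adjacent Q (p ! i) (p ! Suc i))"

text \<open>
  \<open>serpent_path Q S p\<close> means that \<open>S\<close> is a serpent whose path, in one of the two
  directions, is \<open>p\<close>.
\<close>

definition serpent_path :: "'a::linorder dissection \<Rightarrow> 'a set set \<Rightarrow> 'a set list \<Rightarrow> bool" where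
  "serpent_path Q S p \<longleftrightarrow> p \<noteq> [] \<and> square_path Q p \<and> S = {hd p, last p} \<and> hd p \<noteq> last p \<and>
     (\<forall>i. Suc (Suc i) < length p \<longrightarrow>
        \<not> opposite (shared_edge (p ! i) (p ! Suc i)) (shared_edge (p ! Suc i) (p ! Suc (Suc i))))"

definition serpents :: "'a::linorder dissection \<Rightarrow> 'a set set set" where
  "serpents Q = {S. \<exists>p. serpent_path Q S p}"

definition leaves_by :: "'a::linorder dissection \<Rightarrow> 'a set set \<Rightarrow> 'a set \<Rightarrow> 'a set \<Rightarrow> bool" where
  "leaves_by Q S s e \<longleftrightarrow>
     (\<exists>p. serpent_path Q S p \<and> hd p = s \<and> e = shared_edge (p ! 0) (p ! 1))"

definition turns_by ::
    "'a::linorder dissection \<Rightarrow> 'a set set \<Rightarrow> 'a set \<Rightarrow> 'a set \<Rightarrow> 'a set \<Rightarrow> bool" where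
  "turns_by Q S s e f \<longleftrightarrow>
     (\<exists>p i. serpent_path Q S p \<and> Suc (Suc i) < length p \<and> p ! Suc i = s \<and>
        {e, f} = {shared_edge (p ! i) s, shared_edge s (p ! Suc (Suc i))})"

definition nesting :: "'a::linorder dissection \<Rightarrow> 'a set set set \<Rightarrow> bool" where
  "nesting Q N \<longleftrightarrow> N \<subseteq> serpents Q \<and>
     (\<forall>S\<in>N. \<forall>T\<in>N. \<forall>s e f. S \<noteq> T \<and> leaves_by Q S s e \<and> leaves_by Q T s f \<longrightarrow> e \<noteq> f)"

text \<open>
  A path visits every square at most once, so counting segments in a square amounts to counting
  serpents.
\<close>

definition same_pattern ::
    "'a::linorder dissection \<Rightarrow> 'a set set set \<Rightarrow> 'a set set set \<Rightarrow> bool" where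
  "same_pattern Q N N' \<longleftrightarrow>
     (\<forall>s\<in>squares Q. \<forall>e\<in>sides s.
        card {S \<in> N. leaves_by Q S s e} = card {S \<in> N'. leaves_by Q S s e}) \<and>
     (\<forall>s\<in>squares Q. \<forall>e\<in>sides s. \<forall>f\<in>sides s. e \<noteq> f \<and> \<not> opposite e f \<longrightarrow>
        card {S \<in> N. turns_by Q S s e f} = card {S \<in> N'. turns_by Q S s e f})"

definition serpent_nests :: "'a::linorder dissection \<Rightarrow> 'a set set set set set" where
  "serpent_nests Q =
     {N. nesting Q N} // {(N, N'). nesting Q N \<and> nesting Q N' \<and> same_pattern Q N N'}"

end

theory Submission
  imports Defs
begin

text \<open>
  A serpent never goes straight, and the only way through the bridge \<open>s\<close> is straight: its
  two neighbours \<open>t1\<close> and \<open>t2\<close> are attached to opposite sides. Hence a serpent can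
  end in \<open>s\<close> but not pass through it, and its path lies either in \<open>Q1\<close> or in
  \<open>Q2\<close>. As the two pieces share only the square \<open>s\<close>, the serpents of \<open>Q\<close>
  are the disjoint union of the serpents of \<open>Q1\<close> and of \<open>Q2\<close>
  (\<open>serpent_path_glue\<close>, \<open>serpents_disjoint\<close>), and a set of serpents of \<open>Q\<close>
  is a pair of sets \<open>N \<inter> serpents Q1\<close>, \<open>N \<inter> serpents Q2\<close>.

  The two parts do not interact. The nesting condition can relate serpents from both pieces only in
  \<open>s\<close>, but there those of \<open>Q1\<close> leave towards \<open>t1\<close> and those of \<open>Q2\<close>
  towards \<open>t2\<close>, which are different sides (\<open>nesting_glue\<close>). For the same reason every
  single count in a pattern comes from one piece alone, so two sets have the same pattern in
  \<open>Q\<close> iff both their parts have the same patterns (\<open>same_pattern_glue\<close>). The pairing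
  therefore descends to equivalence classes (\<open>bij_betw_quotient_Times\<close>).

  This uses of the geometry only that the pieces glue along \<open>s\<close>, which is the content of the
  locale \<open>glued\<close>. Removing the branch at \<open>t2\<close> must leave a dissection whose squares are
  exactly the remaining squares of \<open>Q\<close>, the two branches must be disjoint, and together with
  \<open>s\<close> they must exhaust \<open>Q\<close>. All three follow from cutting a dissection along an inner
  edge \<open>e\<close>: no square reaches across \<open>e\<close>, so the squares on one side of \<open>e\<close>
  are those of a smaller dissection. Induction along such cuts shows that a side of the polygon
  lies in exactly one square and that the squares are connected by adjacency. The branch beyond the
  edge shared with \<open>t2\<close> is then the full set of squares on the far side of this edge.
\<close>

section \<open>The two half-planes of a chord\<close>

text \<open>
  The closed half-planes \<open>H\<close> and \<open>H'\<close> bounded by the chord \<open>e\<close>. In the linear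
  order one is an interval and the other the complement of an open interval; the relation allows
  both assignments, so that cyclically symmetric arguments need not distinguish them.
\<close>

definition cut :: "'a::linorder set \<Rightarrow> 'a set \<Rightarrow> 'a set \<Rightarrow> bool" where
  "cut e H H' \<longleftrightarrow> (\<exists>a b. a < b \<and> e = {a, b} \<and>
     ((H = {a..b} \<and> H' = {..a} \<union> {b..}) \<or> (H' = {a..b} \<and> H = {..a} \<union> {b..})))"

lemma cut_sym: "cut e H H' \<Longrightarrow> cut e H' H"
  unfolding cut_def by blast

lemma cut_exists:
  assumes "card e = 2"
  shows "\<exists>H H'. cut e H H'"
proof -
  obtain a b where "e = {a, b}" "a < b"
    using assms by (metis card_2_iff insert_commute linorder_neqE)
  then show ?thesis unfolding cut_def by blast
qed

lemma cut_card: "cut e H H' \<Longrightarrow> card e = 2"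
  unfolding cut_def by auto

lemma cut_finite: "cut e H H' \<Longrightarrow> finite e"
  unfolding cut_def by auto

lemma cut_Int: "cut e H H' \<Longrightarrow> H \<inter> H' = e"
  unfolding cut_def by auto

lemma cut_cover: "cut e H H' \<Longrightarrow> x \<in> H \<or> x \<in> H'"
  unfolding cut_def by auto

lemma cut_card_eq:
  assumes "cut d K K'" "cut e H H'" "d \<subseteq> e"
  shows "d = e"
  using assms by (metis card_subset_eq cut_card cut_finite)

lemma not_in_both_halves:
  assumes "cut e H H'" "3 \<le> card F" "F \<subseteq> H" "F \<subseteq> H'"
  shows False
proof -
  have "F \<subseteq> e" using assms cut_Int by blast
  then have "card F \<le> 2" using card_mono[OF cut_finite[OF assms(1)]] cut_card[OF assms(1)] by metis
  then show False using assms(2) by simp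
qed

text \<open>
  Noncrossing chords have nested half-planes: beyond \<open>d\<close> there is no end of \<open>e\<close>, unless
  it is also an end of \<open>d\<close>, so this half-plane of \<open>d\<close> is not divided by \<open>e\<close>.
\<close>

lemma cut_nested:
  assumes "cut d K K'" "cut e H H'" "e \<subseteq> K"
  shows "K' \<subseteq> H \<or> K' \<subseteq> H'"
proof -
  obtain a b where ab: "a < b" "e = {a, b}"
    and H: "(H = {a..b} \<and> H' = {..a} \<union> {b..}) \<or> (H' = {a..b} \<and> H = {..a} \<union> {b..})"
    using assms(2) unfolding cut_def by blast
  obtain x y where xy: "x < y" "d = {x, y}"
    and K: "(K = {x..y} \<and> K' = {..x} \<union> {y..}) \<or> (K' = {x..y} \<and> K = {..x} \<union> {y..})"
    using assms(1) unfolding cut_def by blast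
  have "K' \<subseteq> {a..b} \<or> K' \<subseteq> {..a} \<union> {b..}"
    using K
  proof
    assume k: "K = {x..y} \<and> K' = {..x} \<union> {y..}"
    then have "x \<le> a" "b \<le> y" using assms(3) ab by auto
    then show ?thesis using k by auto
  next
    assume k: "K' = {x..y} \<and> K = {..x} \<union> {y..}"
    then have "(a \<le> x \<or> y \<le> a) \<and> (b \<le> x \<or> y \<le> b)" using assms(3) ab by auto
    then show ?thesis using k ab xy by auto
  qed
  then show ?thesis using H by auto
qed

lemma sides_cut: "e \<in> sides F \<Longrightarrow> \<exists>H H'. cut e H H'"
  unfolding sides_def cut_def by blast

text \<open>
  A side is a supporting chord, which removes the exceptional side from the largest vertex back to
  the smallest one.
\<close>

lemma sides_iff_half:
  assumes "cut e H H'"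
  shows "e \<in> sides F \<longleftrightarrow> e \<subseteq> F \<and> (F \<subseteq> H \<or> F \<subseteq> H')"
proof -
  obtain a b where ab: "a < b" "e = {a, b}"
    and H: "(H = {a..b} \<and> H' = {..a} \<union> {b..}) \<or> (H' = {a..b} \<and> H = {..a} \<union> {b..})"
    using assms unfolding cut_def by blast
  have "e \<in> sides F \<longleftrightarrow> a \<in> F \<and> b \<in> F \<and>
      ((\<forall>x\<in>F. \<not> (a < x \<and> x < b)) \<or> (\<forall>x\<in>F. a \<le> x \<and> x \<le> b))"
    unfolding sides_def using ab by (auto simp: doubleton_eq_iff)
  also have "\<dots> \<longleftrightarrow> e \<subseteq> F \<and> (F \<subseteq> {..a} \<union> {b..} \<or> F \<subseteq> {a..b})"
    using ab by (auto simp: subset_iff not_less)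
  finally show ?thesis using H by blast
qed

lemma sides_subset: "e \<in> sides F \<Longrightarrow> e \<subseteq> F"
  unfolding sides_def by auto

lemma sides_restrict:
  assumes "e \<in> sides V" "e \<subseteq> F" "F \<subseteq> V"
  shows "e \<in> sides F"
  using assms sides_cut sides_iff_half by (metis subset_trans)

lemma noncrossing_half:
  assumes "cut e H H'" "card d = 2" "\<not> crossing e d"
  shows "d \<subseteq> H \<or> d \<subseteq> H'"
proof -
  obtain a b where ab: "a < b" "e = {a, b}"
    and H: "(H = {a..b} \<and> H' = {..a} \<union> {b..}) \<or> (H' = {a..b} \<and> H = {..a} \<union> {b..})"
    using assms(1) unfolding cut_def by blast
  obtain x y where xy: "d = {x, y}" using assms(2) by (metis card_2_iff)
  have "\<not> (a < x \<and> x < b \<and> (y < a \<or> b < y))" "\<not> (a < y \<and> y < b \<and> (x < a \<or> b < x))"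
    using assms(3) ab xy unfolding crossing_def by blast+
  then have "d \<subseteq> {a..b} \<or> d \<subseteq> {..a} \<union> {b..}" using xy ab by auto
  then show ?thesis using H by blast
qed

text \<open>
  A point that is not a vertex of \<open>F\<close> falls between two cyclically consecutive vertices of
  \<open>F\<close>, hence it is cut off by a side of \<open>F\<close>.
\<close>

lemma gap_side:
  fixes F :: "'a::linorder set"
  assumes "finite F" "2 \<le> card F" "c \<notin> F"
  shows "\<exists>d K K'. cut d K K' \<and> d \<subseteq> F \<and> F \<subseteq> K \<and> c \<in> K'"
proof (cases "(\<exists>x\<in>F. x < c) \<and> (\<exists>y\<in>F. c < y)")
  case True
  \<comment> \<open>The nearest vertices below and above \<open>c\<close>.\<close>
  define L U where "L = {x\<in>F. x < c}" and "U = {x\<in>F. c < x}"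
  have fin: "finite L" "finite U" "L \<noteq> {}" "U \<noteq> {}" using assms(1) True by (auto simp: L_def U_def)
  have m: "Max L \<in> L" "Min U \<in> U" using fin by (auto intro: Max_in Min_in)
  then have lt: "Max L < c" "c < Min U" by (auto simp: L_def U_def)
  have "x \<le> Max L \<or> Min U \<le> x" if "x \<in> F" for x
  proof (cases "x < c")
    case True
    then show ?thesis using that fin by (simp add: L_def)
  next
    case False
    then have "c < x" using that assms(3) by (metis linorder_neqE)
    then have "x \<in> U" using that by (simp add: U_def)
    then show ?thesis using fin by simp
  qed
  then have "F \<subseteq> {..Max L} \<union> {Min U..}" by auto
  moreover have "cut {Max L, Min U} ({..Max L} \<union> {Min U..}) {Max L..Min U}"
    using less_trans[OF lt] unfolding cut_def by blast
  moreover have "{Max L, Min U} \<subseteq> F" using m by (auto simp: L_def U_def)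
  moreover have "c \<in> {Max L..Min U}" using lt by auto
  ultimately show ?thesis by blast
next
  case False
  \<comment> \<open>Here \<open>c\<close> lies below or above all of \<open>F\<close>, so cyclically between the largest and the smallest vertex.\<close>
  have ne: "F \<noteq> {}" using assms(2) by auto
  have m: "Min F \<in> F" "Max F \<in> F" using ne assms(1) by auto
  have "Min F \<noteq> Max F"
  proof
    assume eq: "Min F = Max F"
    have "x = Min F" if "x \<in> F" for x
      using that assms(1) eq by (metis Max_ge Min_le antisym)
    then have "F \<subseteq> {Min F}" by blast
    then have "card F \<le> 1" by (metis card_mono card.empty card_insert_disjoint finite.emptyI finite.insertI insert_absorb One_nat_def empty_iff)
    then show False using assms(2) by simp
  qed
  then have lt: "Min F < Max F" using assms(1) m(2) by (simp add: less_le)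
  then have "cut {Min F, Max F} {Min F..Max F} ({..Min F} \<union> {Max F..})"
    unfolding cut_def by blast
  moreover have "F \<subseteq> {Min F..Max F}" using assms(1) by auto
  moreover have "c \<in> {..Min F} \<union> {Max F..}" using False m assms(3) by force
  ultimately show ?thesis using m by blast
qed

section \<open>Dissections and their halves\<close>

text \<open>
  Cells of any size are admitted, so that both halves of a cut are again of the same kind without
  a count of their vertices, and induction over cuts applies.
\<close>

definition dissection :: "'a::linorder dissection \<Rightarrow> bool" where
  "dissection Q \<longleftrightarrow> finite (vertices Q) \<and> 3 \<le> card (vertices Q) \<and>
     inner_edges Q \<subseteq> diagonals (vertices Q) \<and>
     (\<forall>d\<in>inner_edges Q. \<forall>e\<in>inner_edges Q. \<not> crossing d e)"

definition half_dissection :: "'a::linorder dissection \<Rightarrow> 'a set \<Rightarrow> 'a set \<Rightarrow> 'a dissection" where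
  "half_dissection Q e H = \<lparr>vertices = vertices Q \<inter> H,
     inner_edges = {d \<in> inner_edges Q. d \<subseteq> H \<and> d \<noteq> e}\<rparr>"

lemma inner_edgeD:
  assumes "dissection Q" "e \<in> inner_edges Q"
  shows "e \<subseteq> vertices Q" "card e = 2" "e \<notin> sides (vertices Q)"
  using assms unfolding dissection_def diagonals_def by auto

lemma inner_edge_separates:
  assumes "dissection Q" "e \<in> inner_edges Q" "cut e H H'"
  shows "\<exists>x\<in>vertices Q. x \<notin> H" "\<exists>x\<in>vertices Q. x \<notin> H'"
  using inner_edgeD[OF assms(1,2)] sides_iff_half[OF assms(3)] by blast+

lemma inner_edges_half:
  assumes "dissection Q" "e \<in> inner_edges Q" "d \<in> inner_edges Q" "cut e H H'"
  shows "d \<subseteq> H \<or> d \<subseteq> H'"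
  using assms noncrossing_half inner_edgeD(2) unfolding dissection_def by blast

text \<open>
  The chord \<open>e\<close> closes the half polygon. Any other side of it was a side before the cut: its
  supporting half-plane contains both ends of \<open>e\<close>, hence also everything beyond
  \<open>e\<close>.
\<close>

lemma sides_half:
  assumes "dissection Q" "e \<in> inner_edges Q" "cut e H H'"
  shows "sides (vertices Q \<inter> H) = insert e {d \<in> sides (vertices Q). d \<subseteq> H}"
proof (intro equalityI subsetI)
  fix d assume d: "d \<in> sides (vertices Q \<inter> H)"
  show "d \<in> insert e {d \<in> sides (vertices Q). d \<subseteq> H}"
  proof (cases "d = e")
    case False
    have dV: "d \<subseteq> vertices Q" "d \<subseteq> H" using sides_subset[OF d] by auto
    obtain K K' where K: "cut d K K'" "vertices Q \<inter> H \<subseteq> K"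
      using d sides_cut sides_iff_half cut_sym by metis
    have e: "e \<subseteq> vertices Q" "e \<subseteq> H" "e \<subseteq> H'"
      using inner_edgeD(1)[OF assms(1,2)] cut_Int[OF assms(3)] by auto
    have "H' \<subseteq> K \<or> H' \<subseteq> K'" using cut_nested[OF assms(3) K(1) dV(2)] .
    moreover have "\<not> H' \<subseteq> K'"
    proof
      assume "H' \<subseteq> K'"
      then have "e \<subseteq> d" using e K cut_Int[OF K(1)] by blast
      then show False using cut_card_eq[OF assms(3) K(1)] False by simp
    qed
    ultimately have "vertices Q \<subseteq> K" using K(2) cut_cover[OF assms(3)] by blast
    then show ?thesis using sides_iff_half[OF K(1)] dV by blast
  qed simp
next
  fix d assume d: "d \<in> insert e {d \<in> sides (vertices Q). d \<subseteq> H}"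
  have "e \<in> sides (vertices Q \<inter> H)"
    using sides_iff_half[OF assms(3)] inner_edgeD(1)[OF assms(1,2)] cut_Int[OF assms(3)] by blast
  then show "d \<in> sides (vertices Q \<inter> H)"
    using d sides_restrict[of d "vertices Q" "vertices Q \<inter> H"] sides_subset[of d "vertices Q"] by auto
qed

lemma dissection_half:
  assumes "dissection Q" "e \<in> inner_edges Q" "cut e H H'"
  shows "dissection (half_dissection Q e H)"
    and "card (vertices (half_dissection Q e H)) < card (vertices Q)"
proof -
  have fin: "finite (vertices Q)" using assms(1) by (simp add: dissection_def)
  obtain x y where x: "x \<in> vertices Q" "x \<notin> H" and y: "y \<in> vertices Q" "y \<notin> H'"
    using inner_edge_separates[OF assms] by blast
  have e: "e \<subseteq> vertices Q" "card e = 2" "finite e" "e \<subseteq> H" "e \<subseteq> H'"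
    using inner_edgeD[OF assms(1,2)] cut_Int[OF assms(3)] cut_finite[OF assms(3)] by auto
  have "insert y e \<subseteq> vertices Q \<inter> H" using e y cut_cover[OF assms(3)] by blast
  moreover have "card (insert y e) = 3" using e y by (subst card_insert_disjoint) auto
  ultimately have c: "3 \<le> card (vertices Q \<inter> H)" by (metis card_mono fin finite_Int)
  have "d \<in> diagonals (vertices Q \<inter> H)" if "d \<in> inner_edges Q" "d \<subseteq> H" "d \<noteq> e" for d
    using inner_edgeD[OF assms(1) that(1)] that sides_half[OF assms] unfolding diagonals_def by auto
  then show "dissection (half_dissection Q e H)"
    using assms(1) c fin unfolding dissection_def half_dissection_def by auto
  have "vertices Q \<inter> H \<subset> vertices Q" using x by blast
  then show "card (vertices (half_dissection Q e H)) < card (vertices Q)"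
    using fin by (simp add: half_dissection_def psubset_card_mono)
qed

text \<open>
  Within \<open>H\<close> the edge \<open>e\<close> turns from an inner edge into a side of the polygon. Either
  way it may bound a square, and it is no diagonal of a square inside \<open>H\<close>, so the
  conditions on squares are unchanged.
\<close>

lemma squares_half:
  assumes "dissection Q" "e \<in> inner_edges Q" "cut e H H'"
  shows "squares (half_dissection Q e H) = {F \<in> squares Q. F \<subseteq> H}"
proof (intro equalityI subsetI)
  fix F assume F: "F \<in> squares (half_dissection Q e H)"
  then have FH: "F \<subseteq> H" "F \<subseteq> vertices Q" "3 \<le> card F"
    and s: "sides F \<subseteq> sides (vertices Q \<inter> H) \<union> inner_edges Q"
    and d: "diagonals F \<inter> {d \<in> inner_edges Q. d \<subseteq> H \<and> d \<noteq> e} = {}"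
    unfolding squares_def half_dissection_def by auto
  have sub: "sides F \<subseteq> sides (vertices Q) \<union> inner_edges Q"
    using s sides_half[OF assms] assms(2) by auto
  have "e \<notin> diagonals F"
    using FH(1) sides_iff_half[OF assms(3)] unfolding diagonals_def by blast
  moreover have "f \<subseteq> H" if "f \<in> diagonals F" for f
    using that FH(1) unfolding diagonals_def by blast
  ultimately have "diagonals F \<inter> inner_edges Q = {}" using d by blast
  then show "F \<in> {F \<in> squares Q. F \<subseteq> H}"
    using FH sub unfolding squares_def by simp
next
  fix F assume F: "F \<in> {F \<in> squares Q. F \<subseteq> H}"
  then have FH: "F \<subseteq> H" "F \<subseteq> vertices Q" "3 \<le> card F"
    and s: "sides F \<subseteq> sides (vertices Q) \<union> inner_edges Q"
    and d: "diagonals F \<inter> inner_edges Q = {}"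
    unfolding squares_def by auto
  have "f \<in> sides (vertices Q \<inter> H) \<union> {d \<in> inner_edges Q. d \<subseteq> H \<and> d \<noteq> e}"
    if f: "f \<in> sides F" for f
  proof -
    have "f \<subseteq> H" using sides_subset[OF f] FH(1) by blast
    then show ?thesis using f s sides_half[OF assms] by auto
  qed
  then show "F \<in> squares (half_dissection Q e H)"
    using FH d unfolding squares_def half_dissection_def by auto
qed

text \<open>
  A missing vertex is cut off from a square by one of its sides, and this side must be an inner edge,
  as no side of the polygon has vertices beyond it.
\<close>

lemma square_gap:
  assumes "dissection Q" "F \<in> squares Q" "c \<in> vertices Q" "c \<notin> F"
  shows "\<exists>d\<in>inner_edges Q. \<exists>K K'. cut d K K' \<and> F \<subseteq> K \<and> c \<notin> K"
proof -
  have F: "F \<subseteq> vertices Q" "3 \<le> card F" "sides F \<subseteq> sides (vertices Q) \<union> inner_edges Q"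
    using assms(2) unfolding squares_def by auto
  have "finite F" "2 \<le> card F" using F assms(1) finite_subset unfolding dissection_def by auto
  then obtain d K K' where d: "cut d K K'" "d \<subseteq> F" "F \<subseteq> K" "c \<in> K'"
    using gap_side assms(4) by metis
  then have c: "c \<notin> K" using assms(4) cut_Int[OF d(1)] by blast
  have "d \<notin> sides (vertices Q)"
  proof
    assume "d \<in> sides (vertices Q)"
    then have "vertices Q \<subseteq> K'" using sides_iff_half[OF d(1)] c assms(3) by blast
    then show False using not_in_both_halves[OF d(1) F(2) d(3)] F(1) by blast
  qed
  moreover have "d \<in> sides F" using sides_iff_half[OF d(1)] d by blast
  ultimately show ?thesis using F(3) d c by blast
qed

text \<open>
  If the square contains both ends of \<open>e\<close>, then \<open>e\<close> is not a diagonal of it and hence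
  a side. Otherwise an end of \<open>e\<close> is cut off from the square by some inner edge \<open>d\<close>.
  As \<open>e\<close> does not cross \<open>d\<close>, all of \<open>e\<close> lies beyond \<open>d\<close>, and the square
  stays on one side of \<open>e\<close>.
\<close>

lemma square_in_half:
  assumes "dissection Q" "e \<in> inner_edges Q" "cut e H H'" "F \<in> squares Q"
  shows "F \<subseteq> H \<or> F \<subseteq> H'"
proof (cases "e \<subseteq> F")
  case True
  then have "e \<in> sides F"
    using assms(2,4) inner_edgeD(2)[OF assms(1,2)] unfolding squares_def diagonals_def by blast
  then show ?thesis using sides_iff_half[OF assms(3)] by blast
next
  case False
  then obtain c where c: "c \<in> e" "c \<notin> F" by blast
  then obtain d K K' where d: "d \<in> inner_edges Q" "cut d K K'" "F \<subseteq> K" "c \<notin> K"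
    using square_gap[OF assms(1,4)] inner_edgeD(1)[OF assms(1,2)] by blast
  then have "e \<subseteq> K'" using inner_edges_half[OF assms(1) d(1) assms(2) d(2)] c by blast
  then show ?thesis using cut_nested[OF cut_sym[OF d(2)] assms(3)] d(3) by blast
qed

lemma square_not_in_both_halves:
  assumes "cut e H H'" "F \<in> squares Q" "F \<subseteq> H" "F \<subseteq> H'"
  shows False
  using not_in_both_halves assms unfolding squares_def by blast

text \<open>
  Since \<open>cut\<close> is symmetric, the induction hypothesis covers both halves of every cut.
\<close>

lemma dissection_induct [consumes 1, case_names cut]:
  assumes "dissection Q"
    and "\<And>Q. dissection Q \<Longrightarrow>
      (\<And>e H H'. e \<in> inner_edges Q \<Longrightarrow> cut e H H' \<Longrightarrow> P (half_dissection Q e H)) \<Longrightarrow> P Q"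
  shows "P Q"
  using assms(1)
proof (induction Q rule: measure_induct_rule[where f = "\<lambda>Q. card (vertices Q)"])
  case (less Q)
  then show ?case using assms(2) dissection_half by blast
qed

lemma squares_no_inner_edges:
  assumes "dissection Q" "inner_edges Q = {}"
  shows "squares Q = {vertices Q}"
proof -
  have "F = vertices Q" if "F \<in> squares Q" for F
    using square_gap[OF assms(1) that] assms(2) that unfolding squares_def by blast
  moreover have "vertices Q \<in> squares Q" using assms unfolding squares_def dissection_def by auto
  ultimately show ?thesis by blast
qed

text \<open>
  Removing squares leaves the vertices of the remaining ones; this lemma ensures, applied to a half,
  that these are all the vertices of the half polygon.
\<close>

lemma vertices_covered:
  assumes "dissection Q"
  shows "\<Union>(squares Q) = vertices Q"
  using assms
proof (induction rule: dissection_induct)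
  case (cut Q)
  show ?case
  proof (cases "inner_edges Q = {}")
    case True
    then show ?thesis using squares_no_inner_edges[OF cut(1)] by simp
  next
    case False
    then obtain e H H' where e: "e \<in> inner_edges Q" "cut e H H'"
      using inner_edgeD(2)[OF cut(1)] cut_exists by (metis all_not_in_conv)
    note IH = cut(2)[OF e] cut(2)[OF e(1) cut_sym[OF e(2)]]
    have "vertices Q \<inter> H \<subseteq> \<Union>(squares Q)" "vertices Q \<inter> H' \<subseteq> \<Union>(squares Q)"
      using IH squares_half[OF cut(1) e] squares_half[OF cut(1) e(1) cut_sym[OF e(2)]]
      unfolding half_dissection_def by auto
    moreover have "\<Union>(squares Q) \<subseteq> vertices Q" unfolding squares_def by auto
    ultimately show ?thesis using cut_cover[OF e(2)] by blast
  qed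
qed

text \<open>
  A side of the polygon survives as a side in exactly one half of a cut; a square in the other half
  could contain it only if it were the cut itself.
\<close>

lemma side_in_unique_square:
  assumes "dissection Q" "d \<in> sides (vertices Q)"
  shows "\<exists>!F. F \<in> squares Q \<and> d \<in> sides F"
  using assms
proof (induction arbitrary: d rule: dissection_induct)
  case (cut Q)
  show ?case
  proof (cases "inner_edges Q = {}")
    case True
    then show ?thesis using squares_no_inner_edges[OF cut(1)] cut(3) by auto
  next
    case False
    then obtain e H H' where e: "e \<in> inner_edges Q" "cut e H H'"
      using inner_edgeD(2)[OF cut(1)] cut_exists by (metis all_not_in_conv)
    obtain K K' where K: "cut d K K'" "vertices Q \<subseteq> K"
      using cut(3) sides_cut sides_iff_half cut_sym by metis
    have "e \<subseteq> K" using K(2) inner_edgeD(1)[OF cut(1) e(1)] by blast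
    then have "d \<subseteq> H \<or> d \<subseteq> H'" using cut_nested[OF K(1) e(2)] cut_Int[OF K(1)] by blast
    then obtain L L' where L: "cut e L L'" "d \<subseteq> L" using e(2) cut_sym by blast
    have de: "d \<noteq> e" using inner_edgeD(3)[OF cut(1) e(1)] cut(3) by blast
    have "d \<in> sides (vertices (half_dissection Q e L))"
      using sides_half[OF cut(1) e(1) L(1)] cut(3) L(2) unfolding half_dissection_def by auto
    then have ex: "\<exists>!F. (F \<in> squares Q \<and> F \<subseteq> L) \<and> d \<in> sides F"
      using cut(2)[OF e(1) L(1)] squares_half[OF cut(1) e(1) L(1)] by simp
    have "F \<subseteq> L" if F: "F \<in> squares Q" "d \<in> sides F" for F
    proof (rule ccontr)
      assume "\<not> F \<subseteq> L"
      then have "F \<subseteq> L'" using square_in_half[OF cut(1) e(1) L(1) F(1)] by blast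
      then have "d \<subseteq> e" using L(2) sides_subset[OF F(2)] cut_Int[OF L(1)] by blast
      then show False using de cut_card_eq[OF K(1) e(2)] by blast
    qed
    then show ?thesis using ex by metis
  qed
qed

lemma inner_edge_unique_square_in_half:
  assumes "dissection Q" "e \<in> inner_edges Q" "cut e H H'"
  shows "\<exists>!F. F \<in> squares Q \<and> F \<subseteq> H \<and> e \<in> sides F"
proof -
  have "e \<in> sides (vertices (half_dissection Q e H))"
    using sides_half[OF assms] unfolding half_dissection_def by simp
  then have "\<exists>!F. (F \<in> squares Q \<and> F \<subseteq> H) \<and> e \<in> sides F"
    using side_in_unique_square[OF dissection_half(1)[OF assms]] squares_half[OF assms] by simp
  then show ?thesis by (simp add: conj_assoc)
qed

lemma adjacent_sym: "adjacent Q u v \<Longrightarrow> adjacent Q v u"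
  unfolding adjacent_def by blast

lemma adjacent_half:
  assumes "dissection Q" "e \<in> inner_edges Q" "cut e H H'" "adjacent (half_dissection Q e H) u v"
  shows "adjacent Q u v"
  using assms(4) squares_half[OF assms(1-3)] unfolding adjacent_def half_dissection_def by auto

text \<open>
  Each half of a cut \<open>e\<close> is connected by induction, and the two squares along \<open>e\<close>, one
  in each half, are adjacent.
\<close>

lemma squares_connected:
  assumes "dissection Q" "F \<in> squares Q" "G \<in> squares Q"
  shows "(F, G) \<in> {(v, w). adjacent Q v w}\<^sup>*"
  using assms
proof (induction arbitrary: F G rule: dissection_induct)
  case (cut Q)
  show ?case
  proof (cases "inner_edges Q = {}")
    case True
    then show ?thesis using squares_no_inner_edges[OF cut(1)] cut(3,4) by auto
  next
    case False
    let ?R = "{(v, w). adjacent Q v w}\<^sup>*"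
    obtain e H H' where e: "e \<in> inner_edges Q" "cut e H H'"
      using False inner_edgeD(2)[OF cut(1)] cut_exists by (metis all_not_in_conv)
    have same: "(A, B) \<in> ?R"
      if "cut e L L'" "A \<in> squares Q" "B \<in> squares Q" "A \<subseteq> L" "B \<subseteq> L" for A B L L'
    proof -
      have "(A, B) \<in> {(v, w). adjacent (half_dissection Q e L) v w}\<^sup>*"
        using cut(2)[OF e(1) that(1)] squares_half[OF cut(1) e(1) that(1)] that by blast
      then show ?thesis
        using rtrancl_mono[of "{(v, w). adjacent (half_dissection Q e L) v w}" "{(v, w). adjacent Q v w}"]
          adjacent_half[OF cut(1) e(1) that(1)] by blast
    qed
    have across: "(A, B) \<in> ?R"
      if L: "cut e L L'" and A: "A \<in> squares Q" "A \<subseteq> L" and B: "B \<in> squares Q" "B \<subseteq> L'" for A B L L'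
    proof -
      obtain U where U: "U \<in> squares Q" "U \<subseteq> L" "e \<in> sides U"
        using inner_edge_unique_square_in_half[OF cut(1) e(1) L] by blast
      obtain W where W: "W \<in> squares Q" "W \<subseteq> L'" "e \<in> sides W"
        using inner_edge_unique_square_in_half[OF cut(1) e(1) cut_sym[OF L]] by blast
      have "adjacent Q U W"
        using U W e(1) square_not_in_both_halves[OF L] unfolding adjacent_def by blast
      then have "(U, W) \<in> ?R" by blast
      then show ?thesis
        using same[OF L A(1) U(1) A(2) U(2)] same[OF cut_sym[OF L] W(1) B(1) W(2) B(2)]
        by (meson rtrancl_trans)
    qed
    show ?thesis
      using square_in_half[OF cut(1) e cut(3)] square_in_half[OF cut(1) e cut(4)]
        same[OF e(2) cut(3,4)] same[OF cut_sym[OF e(2)] cut(3,4)]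
        across[OF e(2) cut(3) _ cut(4)] across[OF cut_sym[OF e(2)] cut(3) _ cut(4)]
      by blast
  qed
qed

section \<open>Branches\<close>

lemma adjacent_cut:
  assumes "dissection Q" "adjacent Q s t"
  shows "\<exists>e H H'. e \<in> inner_edges Q \<and> cut e H H' \<and> e \<in> sides s \<and> e \<in> sides t \<and> s \<subseteq> H \<and> t \<subseteq> H'"
proof -
  obtain e where e: "e \<in> inner_edges Q" "e \<in> sides s" "e \<in> sides t"
    and st: "s \<in> squares Q" "t \<in> squares Q" "s \<noteq> t"
    using assms(2) unfolding adjacent_def by blast
  obtain H H' where H: "cut e H H'" "s \<subseteq> H"
    using cut_exists[OF inner_edgeD(2)[OF assms(1) e(1)]] square_in_half[OF assms(1) e(1) _ st(1)]
      cut_sym by metis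
  have "\<not> t \<subseteq> H"
    using inner_edge_unique_square_in_half[OF assms(1) e(1) H(1)] e st H(2) by blast
  then have "t \<subseteq> H'" using square_in_half[OF assms(1) e(1) H(1) st(2)] by blast
  then show ?thesis using e H by blast
qed

text \<open>
  Adjacency can lead from one side of \<open>e\<close> to the other only through \<open>e\<close> itself, and the
  only square along \<open>e\<close> on the near side is \<open>s\<close>. Thus a walk from \<open>t\<close> avoiding
  \<open>s\<close> stays beyond \<open>e\<close>; it reaches everything there because the far half is connected.
\<close>

lemma branch_half:
  assumes "dissection Q" "e \<in> inner_edges Q" "cut e H H'"
    and s: "s \<in> squares Q" "e \<in> sides s" "s \<subseteq> H"
    and t: "t \<in> squares Q" "e \<in> sides t" "t \<subseteq> H'"
  shows "branch Q s t = {F \<in> squares Q. F \<subseteq> H'}"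
proof (intro equalityI subsetI)
  let ?R = "{(v, w). adjacent Q v w \<and> v \<noteq> s \<and> w \<noteq> s}"
  fix u assume "u \<in> branch Q s t"
  then have "(t, u) \<in> ?R\<^sup>*" unfolding branch_def by simp
  then show "u \<in> {F \<in> squares Q. F \<subseteq> H'}"
  proof induction
    case base
    show ?case using t by simp
  next
    case (step v w)
    then obtain d where d: "d \<in> sides v" "d \<in> sides w" and w: "w \<in> squares Q" "w \<noteq> s"
      unfolding adjacent_def by blast
    have "\<not> w \<subseteq> H"
    proof
      assume "w \<subseteq> H"
      moreover have "d \<subseteq> e"
        using step(3) \<open>w \<subseteq> H\<close> sides_subset[OF d(1)] sides_subset[OF d(2)] cut_Int[OF assms(3)] by blast
      then have "d = e" using cut_card_eq[OF _ assms(3)] sides_cut[OF d(1)] by blast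
      ultimately show False
        using inner_edge_unique_square_in_half[OF assms(1-3)] s w d(2) by blast
    qed
    then show ?case using square_in_half[OF assms(1-3) w(1)] w(1) by blast
  qed
next
  fix u assume u: "u \<in> {F \<in> squares Q. F \<subseteq> H'}"
  note H' = cut_sym[OF assms(3)]
  note sq = squares_half[OF assms(1,2) H']
  have ns: "v \<noteq> s" if "v \<in> squares (half_dissection Q e H')" for v
    using that sq s square_not_in_both_halves[OF assms(3)] by blast
  have "(t, u) \<in> {(v, w). adjacent (half_dissection Q e H') v w}\<^sup>*"
    using squares_connected[OF dissection_half(1)[OF assms(1,2) H']] sq u t by blast
  moreover have "{(v, w). adjacent (half_dissection Q e H') v w}
      \<subseteq> {(v, w). adjacent Q v w \<and> v \<noteq> s \<and> w \<noteq> s}"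
    using adjacent_half[OF assms(1,2) H'] ns by (auto simp: adjacent_def[of "half_dissection Q e H'"])
  ultimately show "u \<in> branch Q s t"
    unfolding branch_def using rtrancl_mono by blast
qed

text \<open>
  An edge of the half dissection still separates two squares of that half, whereas \<open>e\<close> has
  lost one of its two squares and so is no longer an inner edge.
\<close>

lemma remove_half:
  assumes "dissection Q" "e \<in> inner_edges Q" "cut e H H'"
  shows "remove_squares Q {F \<in> squares Q. F \<subseteq> H'} = half_dissection Q e H"
proof -
  have rest: "squares Q - {F \<in> squares Q. F \<subseteq> H'} = {F \<in> squares Q. F \<subseteq> H}"
    using square_in_half[OF assms] square_not_in_both_halves[OF assms(3)] by blast
  note half = dissection_half(1)[OF assms] and sq = squares_half[OF assms]
  have V: "\<Union>{F \<in> squares Q. F \<subseteq> H} = vertices Q \<inter> H"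
    using vertices_covered[OF half] sq by (simp add: half_dissection_def)
  have "(\<exists>u\<in>{F \<in> squares Q. F \<subseteq> H}. \<exists>v\<in>{F \<in> squares Q. F \<subseteq> H}.
      u \<noteq> v \<and> d \<in> sides u \<and> d \<in> sides v) \<longleftrightarrow> d \<subseteq> H \<and> d \<noteq> e" (is "?L \<longleftrightarrow> _")
    if d: "d \<in> inner_edges Q" for d
  proof
    assume ?L
    then obtain u v where uv: "u \<in> squares Q" "u \<subseteq> H" "v \<in> squares Q" "v \<subseteq> H" "u \<noteq> v"
      and du: "d \<in> sides u" "d \<in> sides v" by blast
    have "d \<noteq> e"
      using inner_edge_unique_square_in_half[OF assms] uv du by metis
    then show "d \<subseteq> H \<and> d \<noteq> e"
      using sides_subset[OF du(1)] uv(2) by blast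
  next
    assume "d \<subseteq> H \<and> d \<noteq> e"
    then have d': "d \<in> inner_edges (half_dissection Q e H)"
      using d by (simp add: half_dissection_def)
    obtain K K' where K: "cut d K K'" using cut_exists inner_edgeD(2)[OF assms(1) d] by blast
    obtain u where u: "u \<in> squares (half_dissection Q e H)" "u \<subseteq> K" "d \<in> sides u"
      using inner_edge_unique_square_in_half[OF half d' K] by blast
    obtain v where v: "v \<in> squares (half_dissection Q e H)" "v \<subseteq> K'" "d \<in> sides v"
      using inner_edge_unique_square_in_half[OF half d' cut_sym[OF K]] by blast
    have "u \<noteq> v" using square_not_in_both_halves[OF K u(1,2)] v(2) by blast
    then show ?L using u v sq by blast
  qed
  then have E: "{d \<in> inner_edges Q. \<exists>u\<in>{F \<in> squares Q. F \<subseteq> H}. \<exists>v\<in>{F \<in> squares Q. F \<subseteq> H}.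
      u \<noteq> v \<and> d \<in> sides u \<and> d \<in> sides v} = {d \<in> inner_edges Q. d \<subseteq> H \<and> d \<noteq> e}"
    by (intro Collect_cong conj_cong refl)
  show ?thesis
    unfolding remove_squares_def rest half_dissection_def V E ..
qed

lemma squares_remove_branch:
  assumes "dissection Q" "adjacent Q s t"
  shows "squares (remove_squares Q (branch Q s t)) = squares Q - branch Q s t"
proof -
  obtain e H H' where e: "e \<in> inner_edges Q" "cut e H H'"
    and "e \<in> sides s" "e \<in> sides t" "s \<subseteq> H" "t \<subseteq> H'"
    using adjacent_cut[OF assms] by blast
  moreover have "s \<in> squares Q" "t \<in> squares Q" using assms(2) unfolding adjacent_def by auto
  ultimately have "branch Q s t = {F \<in> squares Q. F \<subseteq> H'}"
    using branch_half[OF assms(1)] by blast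
  then show ?thesis
    using remove_half[OF assms(1) e] squares_half[OF assms(1) e] square_in_half[OF assms(1) e]
      square_not_in_both_halves[OF e(2)] by auto
qed

text \<open>
  Different neighbours of \<open>s\<close> lie in different branches: beyond the edge shared by \<open>s\<close>
  and \<open>t\<close> the only square that has a side in common with \<open>s\<close> is \<open>t\<close>.
\<close>

lemma neighbour_in_branch:
  assumes "dissection Q" "adjacent Q s t" "adjacent Q s u" "u \<in> branch Q s t"
  shows "u = t"
proof -
  obtain e H H' where e: "e \<in> inner_edges Q" "cut e H H'"
    and es: "e \<in> sides s" "e \<in> sides t" "s \<subseteq> H" "t \<subseteq> H'"
    using adjacent_cut[OF assms(1,2)] by blast
  have sq: "s \<in> squares Q" "t \<in> squares Q" using assms(2) unfolding adjacent_def by auto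
  have u: "u \<in> squares Q" "u \<subseteq> H'"
    using assms(4) branch_half[OF assms(1) e sq(1) es(1,3) sq(2) es(2,4)] by auto
  obtain d where d: "d \<in> sides s" "d \<in> sides u" using assms(3) unfolding adjacent_def by blast
  then have "d \<subseteq> e" using sides_subset u(2) es(3) cut_Int[OF e(2)] by blast
  then have "d = e" using cut_card_eq[OF _ e(2)] sides_cut[OF d(1)] by blast
  then show ?thesis
    using inner_edge_unique_square_in_half[OF assms(1) e(1) cut_sym[OF e(2)]] u d(2) sq es by blast
qed

lemma adjacent_remove_squares:
  assumes "squares (remove_squares Q R) = squares Q - R"
  shows "adjacent (remove_squares Q R) u v \<longleftrightarrow>
    adjacent Q u v \<and> u \<in> squares Q - R \<and> v \<in> squares Q - R"
  using assms unfolding adjacent_def remove_squares_def by auto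

lemma branch_closed:
  assumes "adjacent Q u v" "u \<in> branch Q s t" "u \<noteq> s" "v \<noteq> s"
  shows "v \<in> branch Q s t"
  using assms unfolding branch_def by (auto intro: rtrancl_into_rtrancl)

lemma root_not_in_branch:
  assumes "t \<noteq> s"
  shows "s \<notin> branch Q s t"
proof
  assume "s \<in> branch Q s t"
  then have "(t, s) \<in> {(v, w). adjacent Q v w \<and> v \<noteq> s \<and> w \<noteq> s}\<^sup>*" by (simp add: branch_def)
  then show False using assms by (cases rule: rtranclE) auto
qed

lemma branch_sym: "u \<in> branch Q s t \<Longrightarrow> t \<in> branch Q s u"
proof -
  have "sym {(v, w). adjacent Q v w \<and> v \<noteq> s \<and> w \<noteq> s}"
    by (auto simp: sym_def intro: adjacent_sym)
  then show "u \<in> branch Q s t \<Longrightarrow> t \<in> branch Q s u"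
    unfolding branch_def using sym_rtrancl symD by fastforce
qed

lemma branch_trans: "u \<in> branch Q s t \<Longrightarrow> v \<in> branch Q s u \<Longrightarrow> v \<in> branch Q s t"
  unfolding branch_def by auto

lemma squares_eq_branches:
  assumes "dissection Q" "s \<in> squares Q"
  shows "squares Q = insert s (\<Union>t\<in>neighbours Q s. branch Q s t)" (is "_ = ?B")
proof (intro equalityI subsetI)
  fix u assume "u \<in> squares Q"
  then have "(s, u) \<in> {(v, w). adjacent Q v w}\<^sup>*" using squares_connected assms by blast
  then show "u \<in> ?B"
  proof induction
    case base
    show ?case by simp
  next
    case (step v w)
    have "w \<in> branch Q s w" by (simp add: branch_def)
    then show ?case
      using step branch_closed[of Q v w s] by (cases "v = s"; cases "w = s") (auto simp: neighbours_def)
  qed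
next
  fix u assume "u \<in> ?B"
  moreover have "u \<in> squares Q" if "t \<in> squares Q" "u \<in> branch Q s t" for t
  proof -
    have "(t, u) \<in> {(v, w). adjacent Q v w \<and> v \<noteq> s \<and> w \<noteq> s}\<^sup>*"
      using that(2) by (simp add: branch_def)
    then show ?thesis using that(1) by (cases rule: rtranclE) (auto simp: adjacent_def)
  qed
  ultimately show "u \<in> squares Q" using assms(2) by (auto simp: neighbours_def adjacent_def)
qed

section \<open>Serpents in a glued dissection\<close>

lemma serpent_path_length: "serpent_path Q S p \<Longrightarrow> Suc 0 < length p"
  unfolding serpent_path_def by (cases p; cases "tl p") auto

lemma serpent_path_adjacent:
  "serpent_path Q S p \<Longrightarrow> Suc i < length p \<Longrightarrow> adjacent Q (p ! i) (p ! Suc i)"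
  unfolding serpent_path_def square_path_def by blast

lemma serpent_path_squares:
  assumes "serpent_path Q S p" "i < length p"
  shows "p ! i \<in> squares Q"
proof (cases i)
  case 0
  then show ?thesis
    using serpent_path_adjacent[OF assms(1), of 0] serpent_path_length[OF assms(1)]
    by (simp add: adjacent_def)
next
  case (Suc j)
  then show ?thesis
    using serpent_path_adjacent[OF assms(1), of j] assms(2) by (simp add: adjacent_def)
qed

lemma serpent_squares:
  assumes "S \<in> serpents Q"
  shows "S \<subseteq> squares Q" "card S = 2"
proof -
  obtain p where p: "serpent_path Q S p" using assms unfolding serpents_def by blast
  then have S: "S = {hd p, last p}" "hd p \<noteq> last p" "p \<noteq> []" unfolding serpent_path_def by auto
  then show "S \<subseteq> squares Q"
    using serpent_path_squares[OF p, of 0] serpent_path_squares[OF p, of "length p - 1"]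
    by (simp add: hd_conv_nth last_conv_nth)
  show "card S = 2" using S by simp
qed

lemma leaves_byD:
  assumes "leaves_by Q S u e"
  shows "S \<in> serpents Q" "u \<in> squares Q" "\<exists>v. adjacent Q u v \<and> e = shared_edge u v"
proof -
  obtain p where p: "serpent_path Q S p" "hd p = u" "e = shared_edge (p ! 0) (p ! 1)"
    using assms unfolding leaves_by_def by blast
  have "p ! 0 = u" using p(1,2) by (auto simp: serpent_path_def hd_conv_nth)
  then have "adjacent Q u (p ! 1)" "e = shared_edge u (p ! 1)"
    using serpent_path_adjacent[OF p(1), of 0] serpent_path_length[OF p(1)] p(3) by auto
  then show "u \<in> squares Q" "\<exists>v. adjacent Q u v \<and> e = shared_edge u v"
    unfolding adjacent_def by blast+
  show "S \<in> serpents Q" using p(1) unfolding serpents_def by blast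
qed

lemma turns_byD:
  assumes "turns_by Q S u e f"
  shows "S \<in> serpents Q" "u \<in> squares Q" "\<exists>v w. adjacent Q u v \<and> adjacent Q u w \<and> v \<noteq> w"
proof -
  obtain p i where p: "serpent_path Q S p" "Suc (Suc i) < length p" "p ! Suc i = u"
    using assms unfolding turns_by_def by blast
  have "distinct p" using p(1) unfolding serpent_path_def square_path_def by blast
  then have "p ! i \<noteq> p ! Suc (Suc i)" using p(2) by (simp add: nth_eq_iff_index_eq)
  moreover have "adjacent Q u (p ! i)" "adjacent Q u (p ! Suc (Suc i))"
    using serpent_path_adjacent[OF p(1), of i] serpent_path_adjacent[OF p(1), of "Suc i"] p
      adjacent_sym by auto
  ultimately show "\<exists>v w. adjacent Q u v \<and> adjacent Q u w \<and> v \<noteq> w" by blast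
  show "S \<in> serpents Q" using p(1) unfolding serpents_def by blast
  show "u \<in> squares Q" using serpent_path_squares[OF p(1), of "Suc i"] p by simp
qed

lemma nestingD:
  assumes "nesting Q N" "S \<in> N" "T \<in> N" "leaves_by Q S u e" "leaves_by Q T u e"
  shows "S = T"
  using assms unfolding nesting_def by metis

text \<open>
  Counts at a set that is not a square vanish, so patterns in \<open>Q\<close>, \<open>Q1\<close> and
  \<open>Q2\<close> can be compared over one common range of \<open>u\<close>.
\<close>

lemma same_pattern_iff:
  "same_pattern Q N N' \<longleftrightarrow>
     (\<forall>u. \<forall>e\<in>sides u.
        card {S \<in> N. leaves_by Q S u e} = card {S \<in> N'. leaves_by Q S u e}) \<and>
     (\<forall>u. \<forall>e\<in>sides u. \<forall>f\<in>sides u. e \<noteq> f \<and> \<not> opposite e f \<longrightarrow>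
        card {S \<in> N. turns_by Q S u e f} = card {S \<in> N'. turns_by Q S u e f})"
proof -
  have "\<not> leaves_by Q S u e" "\<not> turns_by Q S u e f" if "u \<notin> squares Q" for S u e f
    using that leaves_byD(2) turns_byD(2) by blast+
  then have "card {S \<in> N. leaves_by Q S u e} = card {S \<in> N'. leaves_by Q S u e}"
    "card {S \<in> N. turns_by Q S u e f} = card {S \<in> N'. turns_by Q S u e f}"
    if "u \<notin> squares Q" for u e f
    using that by simp_all
  then show ?thesis unfolding same_pattern_def by meson
qed

lemma shared_edge_nonempty:
  assumes "adjacent Q u v"
  shows "shared_edge u v \<noteq> {}"
proof -
  obtain e where e: "e \<in> sides u" "e \<in> sides v" using assms unfolding adjacent_def by blast
  then have "e \<noteq> {}" unfolding sides_def by blast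
  then show ?thesis using sides_subset e unfolding shared_edge_def by blast
qed

text \<open>
  \<open>Q\<close> consists of two pieces that overlap in the single square \<open>s\<close>, which has at most
  one neighbour in each piece, and these are attached to opposite sides. The axioms are symmetric in
  the two pieces.
\<close>

locale glued =
  fixes Q Q1 Q2 :: "'a::linorder dissection" and s t1 t2 :: "'a set"
  assumes squares_common: "squares Q1 \<inter> squares Q2 = {s}"
    and squares_glue: "squares Q = squares Q1 \<union> squares Q2"
    and adjacent_glue: "adjacent Q u v \<longleftrightarrow> adjacent Q1 u v \<or> adjacent Q2 u v"
    and neighbour1: "adjacent Q1 s v \<Longrightarrow> v = t1"
    and neighbour2: "adjacent Q2 s v \<Longrightarrow> v = t2"
    and straight: "opposite (shared_edge s t1) (shared_edge s t2)"
begin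

lemma swap: "glued Q Q2 Q1 s t2 t1"
  using squares_common squares_glue adjacent_glue neighbour1 neighbour2 straight
  by unfold_locales (auto simp: opposite_def)

text \<open>
  The step where a path changes from the first piece to the second would lead through the common
  square \<open>s\<close>, from \<open>t1\<close> to \<open>t2\<close>, without a turn.
\<close>

lemma serpent_path_stays:
  assumes "serpent_path Q S p" "adjacent Q1 (p ! 0) (p ! Suc 0)"
  shows "serpent_path Q1 S p"
proof -
  have "adjacent Q1 (p ! i) (p ! Suc i)" if "Suc i < length p" for i
    using that
  proof (induction i)
    case 0
    show ?case using assms(2) .
  next
    case (Suc i)
    let ?u = "p ! Suc i" and ?v = "p ! i" and ?w = "p ! Suc (Suc i)"
    have v: "adjacent Q1 ?u ?v" using Suc adjacent_sym by simp
    have "\<not> adjacent Q2 ?u ?w"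
    proof
      assume w: "adjacent Q2 ?u ?w"
      have u: "?u = s" using v w squares_common unfolding adjacent_def by blast
      have "?v = t1" "?w = t2" using v w u neighbour1 neighbour2 by auto
      moreover have "\<not> opposite (shared_edge ?v ?u) (shared_edge ?u ?w)"
        using assms(1) Suc.prems unfolding serpent_path_def by blast
      ultimately show False using straight u by (simp add: shared_edge_def Int_commute)
    qed
    then show ?case using serpent_path_adjacent[OF assms(1) Suc.prems] adjacent_glue by blast
  qed
  then show ?thesis using assms(1) unfolding serpent_path_def square_path_def by blast
qed

lemma serpent_path_glue:
  "serpent_path Q S p \<longleftrightarrow> serpent_path Q1 S p \<or> serpent_path Q2 S p"
proof
  interpret swap: glued Q Q2 Q1 s t2 t1 by (rule swap)
  assume p: "serpent_path Q S p"
  then have "adjacent Q (p ! 0) (p ! Suc 0)"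
    using serpent_path_adjacent serpent_path_length by blast
  then show "serpent_path Q1 S p \<or> serpent_path Q2 S p"
    using p adjacent_glue serpent_path_stays swap.serpent_path_stays by blast
next
  assume "serpent_path Q1 S p \<or> serpent_path Q2 S p"
  then show "serpent_path Q S p"
    unfolding serpent_path_def square_path_def using adjacent_glue by blast
qed

lemma serpents_glue: "serpents Q = serpents Q1 \<union> serpents Q2"
  unfolding serpents_def using serpent_path_glue by blast

lemma serpents_disjoint: "serpents Q1 \<inter> serpents Q2 = {}"
proof -
  have False if S: "S \<in> serpents Q1" "S \<in> serpents Q2" for S
  proof -
    have "S \<subseteq> {s}" using serpent_squares(1)[OF S(1)] serpent_squares(1)[OF S(2)] squares_common by blast
    then have "card S \<le> card {s}" by (intro card_mono) simp_all
    then show False using serpent_squares(2)[OF S(1)] by simp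
  qed
  then show ?thesis by blast
qed

lemma leaves_by_glue: "leaves_by Q S u e \<longleftrightarrow> leaves_by Q1 S u e \<or> leaves_by Q2 S u e"
  unfolding leaves_by_def serpent_path_glue
  by (simp only: conj_disj_distribR ex_disj_distrib)

lemma turns_by_glue: "turns_by Q S u e f \<longleftrightarrow> turns_by Q1 S u e f \<or> turns_by Q2 S u e f"
  unfolding turns_by_def serpent_path_glue
  by (simp only: conj_disj_distribR ex_disj_distrib)

text \<open>
  Only \<open>s\<close> lies in both pieces, and there the exits are opposite, hence different, sides.
\<close>

lemma leaves_by_exclusive:
  assumes "leaves_by Q1 S u e" "leaves_by Q2 T u e"
  shows False
proof -
  have u: "u = s" using leaves_byD(2)[OF assms(1)] leaves_byD(2)[OF assms(2)] squares_common by blast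
  obtain v where v: "adjacent Q1 s v" "e = shared_edge s v" using leaves_byD(3)[OF assms(1)] u by blast
  obtain w where w: "adjacent Q2 s w" "e = shared_edge s w" using leaves_byD(3)[OF assms(2)] u by blast
  have "e \<inter> e = {}" using straight neighbour1[OF v(1)] neighbour2[OF w(1)] v(2) w(2)
    unfolding opposite_def by simp
  then show False using shared_edge_nonempty[OF v(1)] v(2) by simp
qed

text \<open>
  A turn needs two different neighbours in the same piece, but \<open>s\<close> has at most one.
\<close>

lemma turns_by_exclusive:
  assumes "turns_by Q1 S u e f" "turns_by Q2 T u e' f'"
  shows False
proof -
  have "u = s" using turns_byD(2)[OF assms(1)] turns_byD(2)[OF assms(2)] squares_common by blast
  then show False using turns_byD(3)[OF assms(1)] neighbour1 by blast
qed

lemma nesting_glue: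
  "nesting Q N \<longleftrightarrow>
    N \<subseteq> serpents Q \<and> nesting Q1 (N \<inter> serpents Q1) \<and> nesting Q2 (N \<inter> serpents Q2)"
proof
  assume "nesting Q N"
  then show "N \<subseteq> serpents Q \<and> nesting Q1 (N \<inter> serpents Q1) \<and> nesting Q2 (N \<inter> serpents Q2)"
    unfolding nesting_def leaves_by_glue by simp blast
next
  assume parts: "N \<subseteq> serpents Q \<and> nesting Q1 (N \<inter> serpents Q1) \<and> nesting Q2 (N \<inter> serpents Q2)"
  have "e \<noteq> f" if "S \<in> N" "T \<in> N" "S \<noteq> T" and S: "leaves_by Q S u e" and T: "leaves_by Q T u f"
    for S T u e f
  proof
    assume "e = f"
    then consider "leaves_by Q1 S u f" "leaves_by Q1 T u f" | "leaves_by Q2 S u f" "leaves_by Q2 T u f"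
      using S T leaves_by_glue leaves_by_exclusive by blast
    then show False
    proof cases
      case 1
      then have "S \<in> N \<inter> serpents Q1" "T \<in> N \<inter> serpents Q1" using that leaves_byD(1) by blast+
      then show False using nestingD[of Q1 "N \<inter> serpents Q1"] parts 1 \<open>S \<noteq> T\<close> by blast
    next
      case 2
      then have "S \<in> N \<inter> serpents Q2" "T \<in> N \<inter> serpents Q2" using that leaves_byD(1) by blast+
      then show False using nestingD[of Q2 "N \<inter> serpents Q2"] parts 2 \<open>S \<noteq> T\<close> by blast
    qed
  qed
  then show "nesting Q N" using parts unfolding nesting_def[of Q N] by metis
qed

text \<open>
  Every count in \<open>Q\<close> agrees with the count in one piece, the count in the other being zero.
  So no information is lost by adding the contributions of the pieces, and this holds for infinite
  sets with their default cardinality as well.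
\<close>

lemma card_glue_iff:
  assumes P: "\<And>S. P S \<longleftrightarrow> P1 S \<or> P2 S"
    and P1: "\<And>S. P1 S \<Longrightarrow> S \<in> serpents Q1" and P2: "\<And>S. P2 S \<Longrightarrow> S \<in> serpents Q2"
    and excl: "\<And>S T. P1 S \<Longrightarrow> P2 T \<Longrightarrow> False"
  shows "card {S \<in> N. P S} = card {S \<in> N'. P S} \<longleftrightarrow>
    card {S \<in> N \<inter> serpents Q1. P1 S} = card {S \<in> N' \<inter> serpents Q1. P1 S} \<and>
    card {S \<in> N \<inter> serpents Q2. P2 S} = card {S \<in> N' \<inter> serpents Q2. P2 S}"
proof (cases "\<exists>S. P1 S")
  case True
  then have no: "\<not> P2 S" for S using excl by blast
  then have "{S \<in> M. P S} = {S \<in> M \<inter> serpents Q1. P1 S}" for M using P P1 by blast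
  then show ?thesis using no by simp
next
  case False
  then have "{S \<in> M. P S} = {S \<in> M \<inter> serpents Q2. P2 S}" for M using P P2 by blast
  then show ?thesis using False by simp
qed

lemma same_pattern_glue:
  "same_pattern Q N N' \<longleftrightarrow>
    same_pattern Q1 (N \<inter> serpents Q1) (N' \<inter> serpents Q1) \<and>
    same_pattern Q2 (N \<inter> serpents Q2) (N' \<inter> serpents Q2)"
proof -
  have leaves: "card {S \<in> N. leaves_by Q S u e} = card {S \<in> N'. leaves_by Q S u e} \<longleftrightarrow>
      card {S \<in> N \<inter> serpents Q1. leaves_by Q1 S u e} = card {S \<in> N' \<inter> serpents Q1. leaves_by Q1 S u e} \<and>
      card {S \<in> N \<inter> serpents Q2. leaves_by Q2 S u e} = card {S \<in> N' \<inter> serpents Q2. leaves_by Q2 S u e}"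
    for u e
    by (rule card_glue_iff) (auto simp: leaves_by_glue dest: leaves_byD(1) leaves_by_exclusive)
  have turns: "card {S \<in> N. turns_by Q S u e f} = card {S \<in> N'. turns_by Q S u e f} \<longleftrightarrow>
      card {S \<in> N \<inter> serpents Q1. turns_by Q1 S u e f} = card {S \<in> N' \<inter> serpents Q1. turns_by Q1 S u e f} \<and>
      card {S \<in> N \<inter> serpents Q2. turns_by Q2 S u e f} = card {S \<in> N' \<inter> serpents Q2. turns_by Q2 S u e f}"
    for u e f
    by (rule card_glue_iff) (auto simp: turns_by_glue dest: turns_byD(1) turns_by_exclusive)
  show ?thesis
    unfolding same_pattern_iff leaves turns
    by (simp only: imp_conjR ball_conj_distrib all_conj_distrib conj_ac)
qed

end

section \<open>Serpent nests\<close>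

text \<open>
  A map onto a product, under which a relation is the product of two equivalence relations, induces
  a bijection between the quotients; \<open>f\<close> and \<open>g\<close> are its components.
\<close>

lemma bij_betw_quotient_Times:
  assumes R: "equiv A R" and R1: "equiv A1 R1" and R2: "equiv A2 R2"
    and maps: "\<And>x. x \<in> A \<Longrightarrow> f x \<in> A1 \<and> g x \<in> A2"
    and onto: "\<And>a b. a \<in> A1 \<Longrightarrow> b \<in> A2 \<Longrightarrow> \<exists>x\<in>A. f x = a \<and> g x = b"
    and rel: "\<And>x y. x \<in> A \<Longrightarrow> y \<in> A \<Longrightarrow> (x, y) \<in> R \<longleftrightarrow> (f x, f y) \<in> R1 \<and> (g x, g y) \<in> R2"
  shows "bij_betw (\<lambda>C. (R1 `` (f ` C), R2 `` (g ` C))) (A // R) (A1 // R1 \<times> A2 // R2)"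
proof -
  let ?\<phi> = "\<lambda>C. (R1 `` (f ` C), R2 `` (g ` C))"
  have val: "?\<phi> (R `` {x}) = (R1 `` {f x}, R2 `` {g x})" if x: "x \<in> A" for x
  proof -
    have xx: "x \<in> R `` {x}" using equiv_class_self[OF R x] .
    have y: "R1 `` {f y} = R1 `` {f x}" "R2 `` {g y} = R2 `` {g x}" if "y \<in> R `` {x}" for y
    proof -
      have "(x, y) \<in> R" using that by blast
      moreover have "y \<in> A" using calculation R by (meson equiv_class_eq_iff)
      ultimately have "(f x, f y) \<in> R1" "(g x, g y) \<in> R2" using rel x by blast+
      then show "R1 `` {f y} = R1 `` {f x}" "R2 `` {g y} = R2 `` {g x}"
        using equiv_class_eq[OF R1] equiv_class_eq[OF R2] by metis+
    qed
    have "R1 `` (f ` (R `` {x})) = (\<Union>y\<in>R `` {x}. R1 `` {f y})"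
      "R2 `` (g ` (R `` {x})) = (\<Union>y\<in>R `` {x}. R2 `` {g y})" by blast+
    then show ?thesis using UN_constant_eq[OF xx ballI[OF y(1)]] UN_constant_eq[OF xx ballI[OF y(2)]] by simp
  qed
  show ?thesis
  proof (rule bij_betw_imageI)
    show "inj_on ?\<phi> (A // R)"
    proof (rule inj_onI)
      fix C D assume "C \<in> A // R" "D \<in> A // R" and eq: "?\<phi> C = ?\<phi> D"
      then obtain x y where x: "x \<in> A" "C = R `` {x}" and y: "y \<in> A" "D = R `` {y}"
        by (meson quotientE)
      then have "R1 `` {f x} = R1 `` {f y}" "R2 `` {g x} = R2 `` {g y}"
        using eq val[OF x(1)] val[OF y(1)] by auto
      then have "(f x, f y) \<in> R1" "(g x, g y) \<in> R2"
        using maps x y eq_equiv_class[OF _ R1] eq_equiv_class[OF _ R2] by blast+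
      then have "(x, y) \<in> R" using rel x y by blast
      then show "C = D" using x y equiv_class_eq[OF R] by blast
    qed
    show "?\<phi> ` (A // R) = A1 // R1 \<times> A2 // R2"
    proof (intro equalityI subsetI)
      fix z assume "z \<in> ?\<phi> ` (A // R)"
      then obtain C where C: "C \<in> A // R" "z = ?\<phi> C" by blast
      then obtain x where "x \<in> A" "C = R `` {x}" by (meson quotientE)
      then show "z \<in> A1 // R1 \<times> A2 // R2" using C(2) val maps by (auto intro: quotientI)
    next
      fix z assume "z \<in> A1 // R1 \<times> A2 // R2"
      then obtain a b where "a \<in> A1" "b \<in> A2" and z: "z = (R1 `` {a}, R2 `` {b})"
        by (auto elim!: quotientE)
      then obtain x where x: "x \<in> A" "f x = a" "g x = b" using onto by blast
      then have "z = ?\<phi> (R `` {x})" using val z by simp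
      then show "z \<in> ?\<phi> ` (A // R)" using quotientI[OF x(1)] by blast
    qed
  qed
qed

lemma equiv_same_pattern:
  "equiv {N. nesting Q N} {(N, N'). nesting Q N \<and> nesting Q N' \<and> same_pattern Q N N'}"
proof (rule equivI)
  show "refl_on {N. nesting Q N} {(N, N'). nesting Q N \<and> nesting Q N' \<and> same_pattern Q N N'}"
    by (rule refl_onI) (auto simp: same_pattern_def)
  show "sym {(N, N'). nesting Q N \<and> nesting Q N' \<and> same_pattern Q N N'}"
    by (rule symI) (auto simp: same_pattern_def)
  show "trans {(N, N'). nesting Q N \<and> nesting Q N' \<and> same_pattern Q N N'}"
    by (rule transI) (auto simp: same_pattern_def)
qed auto

lemma (in glued) serpent_nests_glue:
  "\<exists>\<phi>. bij_betw \<phi> (serpent_nests Q) (serpent_nests Q1 \<times> serpent_nests Q2)"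
proof -
  let ?f = "\<lambda>N. N \<inter> serpents Q1" and ?g = "\<lambda>N. N \<inter> serpents Q2"
  have onto: "\<exists>N\<in>{N. nesting Q N}. ?f N = N1 \<and> ?g N = N2"
    if N1: "N1 \<in> {N. nesting Q1 N}" and N2: "N2 \<in> {N. nesting Q2 N}" for N1 N2
  proof
    have sub: "N1 \<subseteq> serpents Q1" "N2 \<subseteq> serpents Q2" using N1 N2 unfolding nesting_def by auto
    show parts: "?f (N1 \<union> N2) = N1 \<and> ?g (N1 \<union> N2) = N2" using sub serpents_disjoint by blast
    show "N1 \<union> N2 \<in> {N. nesting Q N}"
      unfolding mem_Collect_eq nesting_glue using parts sub N1 N2 serpents_glue by auto
  qed
  show ?thesis
    unfolding serpent_nests_def
    by (intro exI, rule bij_betw_quotient_Times[where f = ?f and g = ?g,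
          OF equiv_same_pattern equiv_same_pattern equiv_same_pattern _ onto])
      (auto simp: nesting_glue[of N for N] same_pattern_glue[of N N' for N N'])
qed

lemma bridge_glued:
  assumes Q: "dissection Q" and s: "bridge Q s" and nb: "neighbours Q s = {t1, t2}"
  shows "glued Q (remove_squares Q (branch Q s t2)) (remove_squares Q (branch Q s t1)) s t1 t2"
proof -
  let ?B1 = "branch Q s t1" and ?B2 = "branch Q s t2"
  let ?Q1 = "remove_squares Q ?B2" and ?Q2 = "remove_squares Q ?B1"
  have s_sq: "s \<in> squares Q" using s unfolding bridge_def by blast
  have t: "t1 \<noteq> t2 \<and> opposite (shared_edge s t1) (shared_edge s t2)"
    using s nb unfolding bridge_def opposite_def by (auto simp: doubleton_eq_iff Int_commute)
  have adj: "adjacent Q s t1" "adjacent Q s t2" using nb unfolding neighbours_def by auto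
  have nbs: "v = t1 \<or> v = t2" if "adjacent Q s v" for v
    using that nb by (auto simp: neighbours_def)
  have self: "t1 \<in> ?B1" "t2 \<in> ?B2" by (simp_all add: branch_def)
  have disj: "?B1 \<inter> ?B2 = {}"
  proof -
    have "t2 = t1" if "u \<in> ?B1" "u \<in> ?B2" for u
      using neighbour_in_branch[OF Q adj branch_trans[OF that(1) branch_sym[OF that(2)]]] .
    then show ?thesis using t by blast
  qed
  have s_out: "s \<notin> ?B1" "s \<notin> ?B2"
    using root_not_in_branch adj unfolding adjacent_def by metis+
  have cover: "squares Q = insert s (?B1 \<union> ?B2)"
    using squares_eq_branches[OF Q s_sq] nb by simp
  note sq1 = squares_remove_branch[OF Q adj(2)] and sq2 = squares_remove_branch[OF Q adj(1)]
  note adj1 = adjacent_remove_squares[OF sq1] and adj2 = adjacent_remove_squares[OF sq2]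
  have no_crossover: False if "adjacent Q u v" "u \<in> ?B1" "v \<in> ?B2" for u v
    using branch_closed[OF that(1,2)] that s_out disj by blast
  show ?thesis
  proof
    show "squares ?Q1 \<inter> squares ?Q2 = {s}" unfolding sq1 sq2 using cover s_out by blast
    show "squares Q = squares ?Q1 \<union> squares ?Q2" unfolding sq1 sq2 using disj by blast
    show "adjacent Q u v \<longleftrightarrow> adjacent ?Q1 u v \<or> adjacent ?Q2 u v" for u v
    proof
      assume uv: "adjacent Q u v"
      then have "u \<in> squares Q" "v \<in> squares Q" unfolding adjacent_def by auto
      moreover have "\<not> (u \<in> ?B1 \<and> v \<in> ?B2)" "\<not> (v \<in> ?B1 \<and> u \<in> ?B2)"
        using no_crossover uv adjacent_sym by blast+
      ultimately show "adjacent ?Q1 u v \<or> adjacent ?Q2 u v"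
        unfolding adj1 adj2 using uv disj by blast
    qed (auto simp: adj1 adj2)
    show "v = t1" if "adjacent ?Q1 s v" for v
      using that nbs self unfolding adj1 by blast
    show "v = t2" if "adjacent ?Q2 s v" for v
      using that nbs self unfolding adj2 by blast
    show "opposite (shared_edge s t1) (shared_edge s t2)" using t by simp
  qed
qed

theorem theorem4p1:
  fixes Q Q1 Q2 :: "'a::linorder dissection" and s t1 t2 :: "'a set" and n :: nat
  assumes "quadrangulation n Q"
    and "bridge Q s"
    and "neighbours Q s = {t1, t2}"
    and "Q1 = remove_squares Q (branch Q s t2)"
    and "Q2 = remove_squares Q (branch Q s t1)"
  shows "\<exists>\<phi>. bij_betw \<phi> (serpent_nests Q) (serpent_nests Q1 \<times> serpent_nests Q2)"
proof -
  have "dissection Q" using assms(1) unfolding quadrangulation_def dissection_def by auto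
  then interpret glued Q Q1 Q2 s t1 t2 using bridge_glued assms(2-5) by blast
  show ?thesis by (rule serpent_nests_glue)
qed

end
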